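(* Let $(Q,\cdot,\backslash,/)$ be a middle Bol loop with identity $e$, and let $f_2,g_2:Q^2\to Q$ and $\phi_i,\psi_i:Q^i\to Q$ ($i\in\mathbb{N}$) be defined by $$f_2(x,y)=x/(xy)\ \text{ or }\ f_2(x,y)=(x/y)/x,\qquad g_2(x,y)=x/(yx)\ \text{ or }\ g_2(x,y)=(y\backslash x)/x,$$ $$\phi_i(x_1,\ldots,x_i)=x_i(x_{i-1}(\ldots(x_5(x_4(x_3(x_2x_1))))\ldots)),$$ $$\psi_i(x_1,\ldots,x_i)=((\ldots((x_1/x_2)/x_3)\ldots)/x_{i-1})/x_i.$$ The following are true, where identities are for all $x,y\in Q$ and $n\in\mathbb{N}$, $n\ge1$. 1. $f_2\big(x,\phi_n(y,x,x,\ldots,x)\big)=\psi_n\big(f_2(x,y),x,x,\ldots,x\big)$. 2. $f_2\big(x,\phi_{n+1}(x,y,x,x,\ldots,x,x)\big)=\psi_{n+1}\big(g_2(x,y),x,x,\ldots,x\big)$. 3. $(Q,\cdot)$ has the left alternative property (LAP) if and only if $f_2(x,y)=[x/(x^2y)]x$ for all $x,y$. 4. $(Q,\cdot)$ has the power left alternative property (PLAP) if and only if $\psi_n\big(f_2(x,y),x,x,\ldots,x\big)\cdot (x^ny)=x$ for all $x,y$ and all $n$. 5. If $(Q,\cdot)$ has the LAP, then $(Q,\cdot)$ is of exponent $2$ if and only if $f_2(x,y)=(x/y)x$ for all $x,y$. 6. If $(Q,\cdot)$ has the PLAP, then $(Q,\cdot)$ is of exponent $n$ if and only if $\psi_n\big(f_2(x,y),x,\ldots,x\big)\cdot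 y=x$ for all $x,y$.
   Context: A loop $(Q,\cdot,\backslash,/)$ is a loop $(Q,\cdot)$ with identity $e$, where $x\backslash y$ is the unique $z$ with $x\cdot z=y$ and $x/y$ is the unique $z$ with $z\cdot y=x$. It is a middle Bol loop if $x((yz)\backslash x)=(x/z)(y\backslash x)$ for all $x,y,z$. Middle Bol loops are power associative (every element generates a subgroup), so powers $x^n$ are well defined. In a middle Bol loop the two expressions given for each of $f_2$ and $g_2$ agree. Conventions: $\phi_1(x_1)=\psi_1(x_1)=x_1$; $\phi_n$ and $\psi_n$ take exactly $n$ arguments (so e.g. $\phi_n(y,x,\ldots,x)$ and $\psi_n(w,x,\ldots,x)$ have $n-1$ entries $x$, and $\phi_{n+1}(x,y,x,\ldots,x)$ has $y$ in the second place and $x$ in the other $n$ places; $\phi_2(x,y)=yx$). LAP: $x(xy)=(xx)y$ for all $x,y$. PLAP: $x(\cdots(x(xy))\cdots)=x^ny$ ($n$ factors $x$ on the left-hand side) for all $x,y$ and all $n$. Exponent $n$: $x^n=e$ for all $x\in Q$. *)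

theory Defs
  imports "HOL-Algebra.Group"
begin

text \<open>
  The record type of \<^theory>\<open>HOL-Algebra.Group\<close> supplies carrier, product and identity; a loop is
  such a structure in which the two divisions are uniquely possible.  Associativity is not assumed.
\<close>

locale loop =
  fixes Q :: "('a, 'b) monoid_scheme" (structure)
  assumes m_closed: "\<lbrakk>x \<in> carrier Q; y \<in> carrier Q\<rbrakk> \<Longrightarrow> x \<otimes> y \<in> carrier Q"
    and one_closed: "\<one> \<in> carrier Q"
    and l_one: "x \<in> carrier Q \<Longrightarrow> \<one> \<otimes> x = x"
    and r_one: "x \<in> carrier Q \<Longrightarrow> x \<otimes> \<one> = x"
    and l_division: "\<lbrakk>x \<in> carrier Q; y \<in> carrier Q\<rbrakk> \<Longrightarrow> \<exists>!z. z \<in> carrier Q \<and> x \<otimes> z = y"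
    and r_division: "\<lbrakk>x \<in> carrier Q; y \<in> carrier Q\<rbrakk> \<Longrightarrow> \<exists>!z. z \<in> carrier Q \<and> z \<otimes> y = x"

definition ldiv :: "('a, 'b) monoid_scheme \<Rightarrow> 'a \<Rightarrow> 'a \<Rightarrow> 'a" (infixl "\<setminus>\<index>" 70)
  where "x \<setminus>\<^bsub>Q\<^esub> y = (THE z. z \<in> carrier Q \<and> x \<otimes>\<^bsub>Q\<^esub> z = y)"

definition rdiv :: "('a, 'b) monoid_scheme \<Rightarrow> 'a \<Rightarrow> 'a \<Rightarrow> 'a" (infixl "\<oslash>\<index>" 70)
  where "x \<oslash>\<^bsub>Q\<^esub> y = (THE z. z \<in> carrier Q \<and> z \<otimes>\<^bsub>Q\<^esub> y = x)"

locale middle_bol_loop = loop +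
  assumes middle_bol: "\<lbrakk>x \<in> carrier Q; y \<in> carrier Q; z \<in> carrier Q\<rbrakk> \<Longrightarrow>
    x \<otimes> ((y \<otimes> z) \<setminus> x) = (x \<oslash> z) \<otimes> (y \<setminus> x)"

text \<open>
  The families \<open>\<phi>\<^sub>i\<close> and \<open>\<psi>\<^sub>i\<close> take the list of their \<open>i \<ge> 1\<close> arguments, so the index is the length of
  the list: \<open>phi Q [x\<^sub>1, x\<^sub>2, x\<^sub>3] = x\<^sub>3 (x\<^sub>2 x\<^sub>1)\<close> and \<open>psi Q [x\<^sub>1, x\<^sub>2, x\<^sub>3] = (x\<^sub>1 / x\<^sub>2) / x\<^sub>3\<close>.
  The value at the empty list is irrelevant.
\<close>

definition phi :: "('a, 'b) monoid_scheme \<Rightarrow> 'a list \<Rightarrow> 'a"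
  where "phi Q xs = foldl (\<lambda>a x. x \<otimes>\<^bsub>Q\<^esub> a) (hd xs) (tl xs)"

definition psi :: "('a, 'b) monoid_scheme \<Rightarrow> 'a list \<Rightarrow> 'a"
  where "psi Q xs = foldl (\<lambda>a x. a \<oslash>\<^bsub>Q\<^esub> x) (hd xs) (tl xs)"

definition LAP :: "('a, 'b) monoid_scheme \<Rightarrow> bool"
  where "LAP Q \<longleftrightarrow> (\<forall>x\<in>carrier Q. \<forall>y\<in>carrier Q.
    x \<otimes>\<^bsub>Q\<^esub> (x \<otimes>\<^bsub>Q\<^esub> y) = (x \<otimes>\<^bsub>Q\<^esub> x) \<otimes>\<^bsub>Q\<^esub> y)"

text \<open>
  The library power \<open>x [^] n\<close> is the left-normed product \<open>((\<one> x) x) \<dots> x\<close> with \<open>n\<close> factors \<open>x\<close>; middle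
  Bol loops are power associative, so the bracketing is immaterial there.
\<close>

definition PLAP :: "('a, 'b) monoid_scheme \<Rightarrow> bool"
  where "PLAP Q \<longleftrightarrow> (\<forall>n::nat. n \<ge> 1 \<longrightarrow> (\<forall>x\<in>carrier Q. \<forall>y\<in>carrier Q.
    ((\<lambda>z. x \<otimes>\<^bsub>Q\<^esub> z) ^^ n) y = (x [^]\<^bsub>Q\<^esub> n) \<otimes>\<^bsub>Q\<^esub> y))"

definition has_exponent :: "('a, 'b) monoid_scheme \<Rightarrow> nat \<Rightarrow> bool"
  where "has_exponent Q n \<longleftrightarrow> (\<forall>x\<in>carrier Q. x [^]\<^bsub>Q\<^esub> n = \<one>\<^bsub>Q\<^esub>)"

end

theory Submission
  imports Defs
begin

text \<open>
  The middle Bol identity \<open>x ((y z) \<setminus> x) = (x / z) (y \<setminus> x)\<close> specialises to \<open>x ((x z) \<setminus> x) = x / z\<close>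
  for \<open>y = x\<close>, to \<open>x ((y x) \<setminus> x) = y \<setminus> x\<close> for \<open>z = x\<close>, and to \<open>x (z \<setminus> x) = (x / z) x\<close> when \<open>y\<close> is
  the identity element.  Combining the third with the first two gives
  \<open>x / (x y) = (x / y) / x\<close> and \<open>x / (y x) = (y \<setminus> x) / x\<close>: the two forms of \<open>f\<^sub>2\<close> and of \<open>g\<^sub>2\<close> agree.

  The equation \<open>x / (x y) = (x / y) / x\<close> also says that the map \<open>u \<mapsto> x / u\<close> turns left multiplication
  by \<open>x\<close> into right division by \<open>x\<close>.  Iterating it, as in \<open>rdiv_funpow\<close>, gives
  \<open>\<psi>\<^sub>n (f\<^sub>2(x, y), x, \<dots>, x) = x / (x (\<dots> (x y)))\<close> with \<open>n\<close> factors \<open>x\<close>, which is the first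
  part and, started at \<open>y x\<close>, the second.  The other parts follow because \<open>u \<mapsto> x / u\<close> is injective:
  each of their equations amounts to \<open>x / u = x / v\<close>, hence to \<open>u = v\<close>, where \<open>u\<close> and \<open>v\<close>
  are two of \<open>x (\<dots> (x y))\<close>, \<open>x\<^sup>n y\<close> and \<open>y\<close>; and \<open>x\<^sup>n y = y\<close> for all \<open>y\<close> means that \<open>x\<^sup>n\<close> is the
  identity element.
\<close>

context loop
begin

lemma ldiv_unique:
  assumes "x \<in> carrier Q" "z \<in> carrier Q" "x \<otimes> z = y"
  shows "x \<setminus> y = z"
  unfolding ldiv_def
  by (rule the1_equality) (use l_division m_closed assms in blast)+

lemma rdiv_unique:
  assumes "z \<in> carrier Q" "y \<in> carrier Q" "z \<otimes> y = x"
  shows "x \<oslash> y = z"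
  unfolding rdiv_def
  by (rule the1_equality) (use r_division m_closed assms in blast)+

lemma ldiv_closed:
  assumes "x \<in> carrier Q" "y \<in> carrier Q"
  shows "x \<setminus> y \<in> carrier Q"
  using l_division[OF assms] ldiv_unique[OF assms(1)] by metis

lemma mult_ldiv:
  assumes "x \<in> carrier Q" "y \<in> carrier Q"
  shows "x \<otimes> (x \<setminus> y) = y"
  using l_division[OF assms] ldiv_unique[OF assms(1)] by metis

lemma rdiv_closed:
  assumes "x \<in> carrier Q" "y \<in> carrier Q"
  shows "x \<oslash> y \<in> carrier Q"
  using r_division[OF assms] rdiv_unique[OF _ assms(2)] by metis

lemma rdiv_mult:
  assumes "x \<in> carrier Q" "y \<in> carrier Q"
  shows "(x \<oslash> y) \<otimes> y = x"
  using r_division[OF assms] rdiv_unique[OF _ assms(2)] by metis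

lemma mult_rdiv:
  assumes "x \<in> carrier Q" "y \<in> carrier Q"
  shows "(x \<otimes> y) \<oslash> y = x"
  using assms by (simp add: rdiv_unique)

lemma mult_right_cancel:
  assumes "x \<in> carrier Q" "y \<in> carrier Q" "z \<in> carrier Q"
  shows "x \<otimes> z = y \<otimes> z \<longleftrightarrow> x = y"
  using mult_rdiv assms by metis

lemma rdiv_left_cancel:
  assumes "x \<in> carrier Q" "u \<in> carrier Q" "v \<in> carrier Q"
  shows "x \<oslash> u = x \<oslash> v \<longleftrightarrow> u = v"
  using assms ldiv_unique rdiv_closed rdiv_mult by metis

lemma rdiv_mult_eq_iff:
  assumes "x \<in> carrier Q" "u \<in> carrier Q" "v \<in> carrier Q"
  shows "(x \<oslash> u) \<otimes> v = x \<longleftrightarrow> u = v"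
  using assms rdiv_left_cancel rdiv_unique rdiv_closed rdiv_mult by metis

lemma all_mult_eq_self_iff:
  assumes "a \<in> carrier Q"
  shows "(\<forall>y\<in>carrier Q. a \<otimes> y = y) \<longleftrightarrow> a = \<one>"
  using assms l_one r_one one_closed by metis

lemma nat_pow_closed:
  assumes "x \<in> carrier Q"
  shows "x [^] (n::nat) \<in> carrier Q"
  using assms by (induction n) (simp_all add: nat_pow_def one_closed m_closed)

lemma nat_pow_two:
  assumes "x \<in> carrier Q"
  shows "x [^] (2::nat) = x \<otimes> x"
  using assms by (simp add: nat_pow_def numeral_2_eq_2 l_one)

lemma funpow_mult_closed:
  assumes "x \<in> carrier Q" "y \<in> carrier Q"
  shows "((\<otimes>) x ^^ n) y \<in> carrier Q"
  using assms by (induction n) (simp_all add: m_closed)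

end

lemma foldl_replicate: "foldl f a (replicate n x) = ((\<lambda>b. f b x) ^^ n) a"
  by (induction n arbitrary: a) (simp_all add: funpow_Suc_right del: funpow.simps(2))

lemma phi_Cons_replicate:
  "phi Q (y # replicate n x) = (mult Q x ^^ n) y"
  by (simp add: phi_def foldl_replicate)

lemma phi_Cons_Cons_replicate:
  "phi Q (x # y # replicate n x) = (mult Q x ^^ n) (y \<otimes>\<^bsub>Q\<^esub> x)"
  by (simp add: phi_def foldl_replicate)

lemma psi_Cons_replicate:
  "psi Q (y # replicate n x) = ((\<lambda>a. a \<oslash>\<^bsub>Q\<^esub> x) ^^ n) y"
  by (simp add: psi_def foldl_replicate)

context middle_bol_loop
begin

text \<open>
  Its right-hand side has the shape of the left-hand side of the middle Bol identity, so that
  identity evaluates \<open>(x / (y z)) x\<close>; the two lemmas after it use this with \<open>y = x\<close> and \<open>z = x\<close>.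
\<close>

lemma rdiv_mult_self:
  assumes "x \<in> carrier Q" "z \<in> carrier Q"
  shows "(x \<oslash> z) \<otimes> x = x \<otimes> (z \<setminus> x)"
  using middle_bol[of x \<one> z] assms by (simp add: one_closed l_one ldiv_unique)

text \<open>
  Multiplied on the right by \<open>x\<close>, the left-hand side becomes \<open>x ((x y) \<setminus> x)\<close>, and the middle Bol
  identity whose factor \<open>y\<close> is \<open>x\<close> evaluates this to \<open>x / y\<close>.
\<close>

lemma rdiv_mult_left:
  assumes "x \<in> carrier Q" "y \<in> carrier Q"
  shows "x \<oslash> (x \<otimes> y) = (x \<oslash> y) \<oslash> x"
proof -
  have "x \<setminus> x = \<one>"
    using assms by (simp add: ldiv_unique one_closed r_one)
  then have "(x \<oslash> (x \<otimes> y)) \<otimes> x = x \<oslash> y"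
    using middle_bol[of x x y] assms by (simp add: rdiv_mult_self m_closed rdiv_closed r_one)
  then show ?thesis
    using assms by (metis mult_rdiv rdiv_closed m_closed)
qed

text \<open>The mirror image of the previous lemma, from the middle Bol identity whose factor \<open>z\<close> is \<open>x\<close>.\<close>

lemma rdiv_mult_right:
  assumes "x \<in> carrier Q" "y \<in> carrier Q"
  shows "x \<oslash> (y \<otimes> x) = (y \<setminus> x) \<oslash> x"
proof -
  have "x \<oslash> x = \<one>"
    using assms by (simp add: rdiv_unique one_closed l_one)
  then have "(x \<oslash> (y \<otimes> x)) \<otimes> x = y \<setminus> x"
    using middle_bol[of x y x] assms by (simp add: rdiv_mult_self m_closed ldiv_closed l_one)
  then show ?thesis
    using assms by (metis mult_rdiv rdiv_closed m_closed)
qed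

text \<open>
  The map \<open>u \<mapsto> x / u\<close> intertwines left multiplication by \<open>x\<close> with right division by \<open>x\<close>, hence also
  their iterates.
\<close>

lemma rdiv_funpow:
  assumes "x \<in> carrier Q" "y \<in> carrier Q"
  shows "x \<oslash> ((\<otimes>) x ^^ n) y = ((\<lambda>a. a \<oslash> x) ^^ n) (x \<oslash> y)"
  using assms by (induction n) (simp_all add: rdiv_mult_left funpow_mult_closed)

end

theorem theorem2p3:
  fixes Q :: "('a, 'b) monoid_scheme" (structure)
    and f2 g2 :: "'a \<Rightarrow> 'a \<Rightarrow> 'a"
  assumes "middle_bol_loop Q"
    and f2: "(\<forall>x\<in>carrier Q. \<forall>y\<in>carrier Q. f2 x y = x \<oslash> (x \<otimes> y)) \<or>
             (\<forall>x\<in>carrier Q. \<forall>y\<in>carrier Q. f2 x y = (x \<oslash> y) \<oslash> x)"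
    and g2: "(\<forall>x\<in>carrier Q. \<forall>y\<in>carrier Q. g2 x y = x \<oslash> (y \<otimes> x)) \<or>
             (\<forall>x\<in>carrier Q. \<forall>y\<in>carrier Q. g2 x y = (y \<setminus> x) \<oslash> x)"
  shows "(\<forall>n\<ge>1. \<forall>x\<in>carrier Q. \<forall>y\<in>carrier Q.
            f2 x (phi Q (y # replicate (n - 1) x)) = psi Q (f2 x y # replicate (n - 1) x))
       \<and> (\<forall>n\<ge>1. \<forall>x\<in>carrier Q. \<forall>y\<in>carrier Q.
            f2 x (phi Q (x # y # replicate (n - 1) x)) = psi Q (g2 x y # replicate n x))
       \<and> (LAP Q \<longleftrightarrow>
            (\<forall>x\<in>carrier Q. \<forall>y\<in>carrier Q. f2 x y = (x \<oslash> ((x [^] (2::nat)) \<otimes> y)) \<otimes> x))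
       \<and> (PLAP Q \<longleftrightarrow>
            (\<forall>n\<ge>1. \<forall>x\<in>carrier Q. \<forall>y\<in>carrier Q.
               psi Q (f2 x y # replicate (n - 1) x) \<otimes> ((x [^] n) \<otimes> y) = x))
       \<and> (LAP Q \<longrightarrow>
            (has_exponent Q 2 \<longleftrightarrow>
               (\<forall>x\<in>carrier Q. \<forall>y\<in>carrier Q. f2 x y = (x \<oslash> y) \<otimes> x)))
       \<and> (PLAP Q \<longrightarrow>
            (\<forall>n\<ge>1. has_exponent Q n \<longleftrightarrow>
               (\<forall>x\<in>carrier Q. \<forall>y\<in>carrier Q.
                  psi Q (f2 x y # replicate (n - 1) x) \<otimes> y = x)))"
proof -
  interpret middle_bol_loop Q by fact
  have f2_eq: "f2 x y = x \<oslash> (x \<otimes> y)" if "x \<in> carrier Q" "y \<in> carrier Q" for x y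
    using f2 that rdiv_mult_left by auto
  have g2_eq: "g2 x y = x \<oslash> (y \<otimes> x)" if "x \<in> carrier Q" "y \<in> carrier Q" for x y
    using g2 that rdiv_mult_right by auto
  have psi_f2: "psi Q (f2 x y # replicate (n - 1) x) = x \<oslash> ((\<otimes>) x ^^ n) y"
    if "n \<ge> 1" "x \<in> carrier Q" "y \<in> carrier Q" for n x y
  proof -
    obtain k where n: "n = Suc k"
      using \<open>n \<ge> 1\<close> by (cases n) auto
    have "psi Q (f2 x y # replicate (n - 1) x) = x \<oslash> ((\<otimes>) x ^^ k) (x \<otimes> y)"
      using that by (simp add: n psi_Cons_replicate f2_eq rdiv_funpow m_closed)
    then show ?thesis
      by (simp add: n funpow_swap1)
  qed

  have 1: "\<forall>n\<ge>1. \<forall>x\<in>carrier Q. \<forall>y\<in>carrier Q.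
      f2 x (phi Q (y # replicate (n - 1) x)) = psi Q (f2 x y # replicate (n - 1) x)"
  proof (intro allI impI ballI)
    fix n :: nat and x y
    assume "n \<ge> 1" and xy: "x \<in> carrier Q" "y \<in> carrier Q"
    then obtain k where n: "n = Suc k"
      by (cases n) auto
    show "f2 x (phi Q (y # replicate (n - 1) x)) = psi Q (f2 x y # replicate (n - 1) x)"
      using psi_f2[of n x y] xy by (simp add: n phi_Cons_replicate f2_eq funpow_mult_closed)
  qed

  have 2: "\<forall>n\<ge>1. \<forall>x\<in>carrier Q. \<forall>y\<in>carrier Q.
      f2 x (phi Q (x # y # replicate (n - 1) x)) = psi Q (g2 x y # replicate n x)"
  proof (intro allI impI ballI)
    fix n :: nat and x y
    assume "n \<ge> 1" and xy: "x \<in> carrier Q" "y \<in> carrier Q"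
    then obtain k where n: "n = Suc k"
      by (cases n) auto
    have "f2 x (phi Q (x # y # replicate (n - 1) x)) = x \<oslash> ((\<otimes>) x ^^ n) (y \<otimes> x)"
      using xy by (simp add: n phi_Cons_Cons_replicate f2_eq funpow_mult_closed m_closed)
    also have "\<dots> = psi Q (g2 x y # replicate n x)"
      using xy by (simp only: psi_Cons_replicate g2_eq rdiv_funpow m_closed)
    finally show "f2 x (phi Q (x # y # replicate (n - 1) x)) = psi Q (g2 x y # replicate n x)" .
  qed

  have lap_iff: "x \<otimes> (x \<otimes> y) = (x \<otimes> x) \<otimes> y \<longleftrightarrow> f2 x y = (x \<oslash> ((x [^] (2::nat)) \<otimes> y)) \<otimes> x"
    if xy: "x \<in> carrier Q" "y \<in> carrier Q" for x y
  proof -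
    \<comment> \<open>The value \<open>f\<^sub>2(x, y)\<close> is itself a product with right factor \<open>x\<close>, so that factor can be cancelled.\<close>
    have "f2 x y = (x \<oslash> (x \<otimes> (x \<otimes> y))) \<otimes> x"
      using xy by (simp add: f2_eq rdiv_mult_left[of x "x \<otimes> y"] m_closed rdiv_closed rdiv_mult)
    then show ?thesis
      using xy by (simp add: nat_pow_two mult_right_cancel rdiv_left_cancel m_closed rdiv_closed)
  qed
  have 3: "LAP Q \<longleftrightarrow>
      (\<forall>x\<in>carrier Q. \<forall>y\<in>carrier Q. f2 x y = (x \<oslash> ((x [^] (2::nat)) \<otimes> y)) \<otimes> x)"
    unfolding LAP_def using lap_iff by simp

  have 4: "PLAP Q \<longleftrightarrow>
      (\<forall>n\<ge>1. \<forall>x\<in>carrier Q. \<forall>y\<in>carrier Q.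
         psi Q (f2 x y # replicate (n - 1) x) \<otimes> ((x [^] n) \<otimes> y) = x)"
    unfolding PLAP_def
    using psi_f2 by (simp add: rdiv_mult_eq_iff funpow_mult_closed m_closed nat_pow_closed)

  have 5: "has_exponent Q 2 \<longleftrightarrow> (\<forall>x\<in>carrier Q. \<forall>y\<in>carrier Q. f2 x y = (x \<oslash> y) \<otimes> x)" if "LAP Q"
  proof -
    have "f2 x y = (x \<oslash> y) \<otimes> x \<longleftrightarrow> x [^] (2::nat) \<otimes> y = y"
      if "x \<in> carrier Q" "y \<in> carrier Q" for x y
      using that 3 \<open>LAP Q\<close>
      by (simp add: mult_right_cancel rdiv_left_cancel m_closed rdiv_closed nat_pow_closed)
    then show ?thesis
      unfolding has_exponent_def using all_mult_eq_self_iff nat_pow_closed by simp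
  qed

  have 6: "has_exponent Q n \<longleftrightarrow>
      (\<forall>x\<in>carrier Q. \<forall>y\<in>carrier Q. psi Q (f2 x y # replicate (n - 1) x) \<otimes> y = x)"
    if "PLAP Q" "n \<ge> 1" for n
  proof -
    have "psi Q (f2 x y # replicate (n - 1) x) \<otimes> y = x \<longleftrightarrow> x [^] n \<otimes> y = y"
      if xy: "x \<in> carrier Q" "y \<in> carrier Q" for x y
    proof -
      have "((\<otimes>) x ^^ n) y = x [^] n \<otimes> y"
        using \<open>PLAP Q\<close> \<open>n \<ge> 1\<close> xy unfolding PLAP_def by blast
      then show ?thesis
        using psi_f2[OF \<open>n \<ge> 1\<close> xy] xy by (simp add: rdiv_mult_eq_iff m_closed nat_pow_closed)
    qed
    then show ?thesis
      unfolding has_exponent_def using all_mult_eq_self_iff nat_pow_closed by simp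
  qed

  show ?thesis
    using 1 2 3 4 5 6 by blast
qed

end
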